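(* Let $\mathcal{X}$ be a Borel subset of $\mathbb{R}^{\mathbb{N}}$. Suppose that there is a probability measure $P$ on $\mathcal{X}$ such that $$\liminf_{k\to\infty}\ \mathbb{E}\exp\Big\{\sum_{n=1}^k x_n y_n\Big\}<\infty,$$ where $\{x_n\}$ and $\{y_n\}$ are sampled independently from $P$. Then $\mathcal{X}$ does not admit detection.
   Context: $\mathbb{R}^{\mathbb{N}}$ carries the product topology and its Borel $\sigma$-field. Noise: $\xi=(\xi_n)_{n\in\mathbb{N}}$ is a sequence of independent standard real Gaussian random variables. A set $\mathcal{X}\subset\mathbb{R}^{\mathbb{N}}$ admits detection if there is a Borel measurable map $T:\mathbb{R}^{\mathbb{N}}\to\{0,1\}$ such that $T(\xi)=0$ almost surely and, for every $x\in\mathcal{X}$, $T(x+\xi)=1$ almost surely. *)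

theory Defs
  imports "HOL-Probability.Probability"
begin

text \<open>
  Sequences of reals are functions \<open>nat \<Rightarrow> real\<close>, indexed from 0. The topology on this type is the
  product topology, so \<open>borel :: (nat \<Rightarrow> real) measure\<close> carries the Borel sets of the product.
\<close>

definition standard_gaussian_noise :: "'a measure \<Rightarrow> (nat \<Rightarrow> 'a \<Rightarrow> real) \<Rightarrow> bool" where
  "standard_gaussian_noise M \<xi> \<longleftrightarrow>
     prob_space M \<and>
     prob_space.indep_vars M (\<lambda>_. borel) \<xi> UNIV \<and>
     (\<forall>n. distributed M lborel (\<xi> n) (\<lambda>t. ennreal (std_normal_density t)))"

definition admits_detection ::
  "'a measure \<Rightarrow> (nat \<Rightarrow> 'a \<Rightarrow> real) \<Rightarrow> (nat \<Rightarrow> real) set \<Rightarrow> bool" where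
  "admits_detection M \<xi> X \<longleftrightarrow>
     (\<exists>T :: (nat \<Rightarrow> real) \<Rightarrow> nat.
        T \<in> borel \<rightarrow>\<^sub>M count_space {0, 1} \<and>
        (AE \<omega> in M. T (\<lambda>n. \<xi> n \<omega>) = 0) \<and>
        (\<forall>x\<in>X. AE \<omega> in M. T (\<lambda>n. x n + \<xi> n \<omega>) = 1))"

end

theory Submission
  imports Defs
begin

text \<open>
  Let \<open>G\<close> be the law of the noise and \<open>Q\<close> the law of an independent sum of a signal drawn from
  \<open>P\<close> and the noise. By Cameron--Martin, the first \<open>k\<close> coordinates of \<open>Q\<close> have a density \<open>L\<close> with
  respect to those of \<open>G\<close>, and the second moment of \<open>L\<close> is the \<open>k\<close>-th expectation in the hypothesis.
  By Cauchy--Schwarz, \<open>Q(B)\<^sup>2 \<le> C G(B)\<close> for every \<open>B\<close> depending on the first \<open>k\<close> coordinates, where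
  \<open>C\<close> is the same for infinitely many \<open>k\<close>. A compact set is a decreasing intersection of such sets,
  so by inner regularity \<open>Q\<close> is absolutely continuous with respect to \<open>G\<close>, whereas a detecting map
  \<open>T\<close> would give \<open>G(T = 1) = 0\<close> and \<open>Q(T = 1) = 1\<close>.
\<close>

section \<open>The standard Gaussian product measure\<close>

abbreviation std_gaussian :: "real measure" where
  "std_gaussian \<equiv> density lborel (\<lambda>t. ennreal (std_normal_density t))"

definition gaussian_seq :: "(nat \<Rightarrow> real) measure" where
  "gaussian_seq = PiM UNIV (\<lambda>_. std_gaussian)"

text \<open>The Cameron-Martin factor for shifting the coordinates in \<open>S\<close> by
  \<open>a\<close>; coordinates outside \<open>S\<close> do not enter.\<close>

definition shift_density :: "nat set \<Rightarrow> (nat \<Rightarrow> real) \<Rightarrow> (nat \<Rightarrow> real) \<Rightarrow> ennreal" where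
  "shift_density S a z = (\<Prod>n\<in>S. ennreal (exp (a n * z n - (a n)\<^sup>2 / 2)))"

lemma prob_space_std_gaussian: "prob_space std_gaussian"
  using prob_space_normal_density[of 1 0] by simp

interpretation gaussian_seq: product_prob_space "\<lambda>_::nat. std_gaussian" UNIV
  by (intro product_prob_spaceI prob_space_std_gaussian)

lemma sets_gaussian_seq [simp, measurable_cong]: "sets gaussian_seq = sets borel"
proof -
  have "sets gaussian_seq = sets (PiM UNIV (\<lambda>_::nat. borel :: real measure))"
    unfolding gaussian_seq_def by (intro sets_PiM_cong) auto
  then show ?thesis by (simp add: sets_PiM_equal_borel)
qed

lemma space_gaussian_seq [simp]: "space gaussian_seq = UNIV"
  using sets_eq_imp_space_eq[OF sets_gaussian_seq] by simp

lemma prob_space_gaussian_seq: "prob_space gaussian_seq"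
  unfolding gaussian_seq_def by (rule prob_space_PiM) (rule prob_space_std_gaussian)

lemma measurable_seq_component [measurable (raw)]:
  fixes f :: "'b \<Rightarrow> nat \<Rightarrow> real"
  assumes "f \<in> N \<rightarrow>\<^sub>M borel"
  shows "(\<lambda>p. f p n) \<in> borel_measurable N"
  using measurable_compose[OF assms, of "\<lambda>x. x n"] by simp

lemma measurable_seq_add [measurable (raw)]:
  fixes f g :: "'b \<Rightarrow> nat \<Rightarrow> real"
  assumes [measurable]: "f \<in> N \<rightarrow>\<^sub>M borel" "g \<in> N \<rightarrow>\<^sub>M borel"
  shows "(\<lambda>p n. f p n + g p n) \<in> N \<rightarrow>\<^sub>M borel"
  by (rule measurable_coordinatewise_then_product) measurable

lemma measurable_shift_density [measurable (raw)]:
  assumes [measurable]: "f \<in> N \<rightarrow>\<^sub>M borel" "g \<in> N \<rightarrow>\<^sub>M borel"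
  shows "(\<lambda>p. shift_density S (f p) (g p)) \<in> borel_measurable N"
  unfolding shift_density_def by measurable

text \<open>The integrand sees only the coordinates in \<open>J\<close>, whose joint law is a finite
  product measure.\<close>

lemma nn_integral_gaussian_seq_prod:
  assumes "finite J" and [measurable]: "\<And>j. j \<in> J \<Longrightarrow> f j \<in> borel_measurable borel"
  shows "(\<integral>\<^sup>+z. (\<Prod>j\<in>J. f j (z j)) \<partial>gaussian_seq) = (\<Prod>j\<in>J. \<integral>\<^sup>+t. f j t \<partial>std_gaussian)"
proof -
  have "(\<Prod>j\<in>J. \<integral>\<^sup>+t. f j t \<partial>std_gaussian) = (\<integral>\<^sup>+z. (\<Prod>j\<in>J. f j (z j)) \<partial>PiM J (\<lambda>_. std_gaussian))"
    by (rule gaussian_seq.product_nn_integral_prod[symmetric]) (use assms in auto)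
  also have "\<dots> = (\<integral>\<^sup>+z. (\<Prod>j\<in>J. f j (z j)) \<partial>distr gaussian_seq (PiM J (\<lambda>_. std_gaussian)) (\<lambda>x. restrict x J))"
    unfolding gaussian_seq_def using gaussian_seq.distr_PiM_restrict_finite[OF \<open>finite J\<close>] by simp
  also have "\<dots> = (\<integral>\<^sup>+z. (\<Prod>j\<in>J. f j (restrict z J j)) \<partial>gaussian_seq)"
  proof (rule nn_integral_distr)
    show "(\<lambda>x. restrict x J) \<in> gaussian_seq \<rightarrow>\<^sub>M PiM J (\<lambda>_. std_gaussian)"
      unfolding gaussian_seq_def by (rule measurable_restrict_subset) simp
    have "(\<lambda>z. f j (z j)) \<in> borel_measurable (PiM J (\<lambda>_. std_gaussian))" if "j \<in> J" for j
      by (rule measurable_compose[OF measurable_component_singleton[OF that]]) (use assms that in simp)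
    then show "(\<lambda>z. \<Prod>j\<in>J. f j (z j)) \<in>
        borel_measurable (distr gaussian_seq (PiM J (\<lambda>_. std_gaussian)) (\<lambda>x. restrict x J))"
      by simp
  qed
  finally show ?thesis by simp
qed

section \<open>Change of measure under shifts (Cameron-Martin)\<close>

text \<open>One-dimensional Cameron-Martin formula: translate Lebesgue measure by \<open>a\<close>
  and complete the square.\<close>

lemma nn_integral_std_gaussian_translate:
  assumes [measurable]: "h \<in> borel_measurable borel"
  shows "(\<integral>\<^sup>+t. h (a + t) \<partial>std_gaussian) =
    (\<integral>\<^sup>+t. ennreal (exp (a * t - a\<^sup>2 / 2)) * h t \<partial>std_gaussian)"
proof -
  have *: "std_normal_density (a + t) * exp (a * (a + t) - a\<^sup>2 / 2) = std_normal_density t" for t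
    by (simp add: std_normal_density_def flip: exp_add) (simp add: field_simps power2_eq_square)
  \<comment> \<open>Translation invariance is used backwards: \<open>lborel\<close> is written as
    its own image under translation by \<open>a\<close>, so that \<open>t\<close> becomes
    \<open>a + t\<close> in the next step.\<close>
  have "(\<integral>\<^sup>+t. ennreal (exp (a * t - a\<^sup>2 / 2)) * h t \<partial>std_gaussian) =
     (\<integral>\<^sup>+t. ennreal (std_normal_density t) * (ennreal (exp (a * t - a\<^sup>2 / 2)) * h t) \<partial>distr lborel borel ((+) a))"
    unfolding lborel_distr_plus by (simp add: nn_integral_density)
  also have "\<dots> = (\<integral>\<^sup>+t. ennreal (std_normal_density t) * h (a + t) \<partial>lborel)"
    by (subst nn_integral_distr) (simp_all add: * mult.assoc[symmetric] flip: ennreal_mult)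
  also have "\<dots> = (\<integral>\<^sup>+t. h (a + t) \<partial>std_gaussian)"
    by (simp add: nn_integral_density)
  finally show ?thesis ..
qed

text \<open>The correlation of two Cameron-Martin factors is the exponential in the hypothesis.
  Independence reduces it to a single coordinate.\<close>

lemma nn_integral_shift_density_mult:
  assumes "finite S"
  shows "(\<integral>\<^sup>+z. shift_density S a z * shift_density S b z \<partial>gaussian_seq) =
    ennreal (exp (\<Sum>n\<in>S. a n * b n))"
proof -
  have 1: "(\<integral>\<^sup>+t. ennreal (exp (a n * t - (a n)\<^sup>2 / 2)) * ennreal (exp (b n * t - (b n)\<^sup>2 / 2)) \<partial>std_gaussian)
      = ennreal (exp (a n * b n))" for n
  proof -
    \<comment> \<open>The product of the two factors is the factor for the shift \<open>?c\<close>
      times the constant \<open>exp (a n * b n)\<close>. The translation formula for a constant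
      \<open>h\<close> then removes the factor.\<close>
    let ?c = "a n + b n"
    have "(\<integral>\<^sup>+t. ennreal (exp (a n * t - (a n)\<^sup>2 / 2)) * ennreal (exp (b n * t - (b n)\<^sup>2 / 2)) \<partial>std_gaussian)
      = (\<integral>\<^sup>+t. ennreal (exp (?c * t - ?c\<^sup>2 / 2)) * ennreal (exp (a n * b n)) \<partial>std_gaussian)"
      by (intro nn_integral_cong) 
         (simp flip: ennreal_mult exp_add, simp add: power2_eq_square field_simps)
    also have "\<dots> = (\<integral>\<^sup>+t. ennreal (exp (a n * b n)) \<partial>std_gaussian)"
      by (rule nn_integral_std_gaussian_translate[symmetric]) simp
    also have "\<dots> = ennreal (exp (a n * b n))"
      using prob_space.emeasure_space_1[OF prob_space_std_gaussian] by simp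
    finally show ?thesis .
  qed
  have "(\<integral>\<^sup>+z. shift_density S a z * shift_density S b z \<partial>gaussian_seq) =
    (\<integral>\<^sup>+z. (\<Prod>n\<in>S. ennreal (exp (a n * z n - (a n)\<^sup>2 / 2)) * ennreal (exp (b n * z n - (b n)\<^sup>2 / 2))) \<partial>gaussian_seq)"
    by (simp add: shift_density_def prod.distrib)
  also have "\<dots> = (\<Prod>n\<in>S. ennreal (exp (a n * b n)))"
    by (subst nn_integral_gaussian_seq_prod) (simp_all add: 1 assms)
  also have "\<dots> = ennreal (exp (\<Sum>n\<in>S. a n * b n))"
    by (simp add: exp_sum assms prod_ennreal)
  finally show ?thesis .
qed

text \<open>Boxes over finitely many coordinates determine a finite measure on the product. On a box
  both sides factor, and the one-dimensional translation formula compares the factors.\<close>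

lemma distr_gaussian_seq_shift:
  assumes "finite S" and a: "\<And>n. n \<notin> S \<Longrightarrow> a n = 0"
  shows "distr gaussian_seq borel (\<lambda>z n. a n + z n) = density gaussian_seq (shift_density S a)"
proof (rule measure_eqI_PiM_infinite[where I = UNIV and M = "\<lambda>_. std_gaussian"])
  let ?D = "distr gaussian_seq borel (\<lambda>z n. a n + z n)"
  have PiM: "sets (PiM UNIV (\<lambda>_::nat. std_gaussian)) = sets borel"
    using sets_gaussian_seq unfolding gaussian_seq_def .
  show "sets ?D = sets (PiM UNIV (\<lambda>_. std_gaussian))"
    "sets (density gaussian_seq (shift_density S a)) = sets (PiM UNIV (\<lambda>_. std_gaussian))"
    by (simp_all add: PiM)
  interpret prob_space ?D
    by (rule prob_space.prob_space_distr[OF prob_space_gaussian_seq]) measurable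
  show "finite_measure ?D" by (rule finite_measure_axioms)
  fix F :: "nat \<Rightarrow> real set" and J :: "nat set"
  assume J: "finite J" and F: "\<And>j. j \<in> J \<Longrightarrow> F j \<in> sets std_gaussian"
  \<comment> \<open>Extending the sides by \<open>UNIV\<close> off \<open>J\<close> lets the box and
    the density both be products over \<open>J \<union> S\<close>.\<close>
  define F' where "F' j = (if j \<in> J then F j else UNIV)" for j
  have [measurable]: "F' j \<in> sets borel" for j
    using F by (auto simp: F'_def)
  have fin: "finite (J \<union> S)" using J assms by simp
  let ?E = "prod_emb UNIV (\<lambda>_. std_gaussian) J (Pi\<^sub>E J F)"
  have E [measurable]: "?E \<in> sets borel"
    using J F by (auto simp: PiM[symmetric] intro!: sets_PiM_I)
  have ind: "indicator ?E z = (\<Prod>j\<in>J \<union> S. indicator (F' j) (z j) :: ennreal)" for z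
  proof (cases "z \<in> ?E")
    case True
    then have "z j \<in> F' j" for j
      by (auto simp: prod_emb_def F'_def PiE_iff)
    with True show ?thesis by simp
  next
    case False
    then obtain j where "j \<in> J" "z j \<notin> F' j"
      by (auto simp: prod_emb_def F'_def PiE_iff)
    with fin have "(\<Prod>j\<in>J \<union> S. indicator (F' j) (z j) :: ennreal) = 0"
      by (intro prod_zero bexI[of _ j]) auto
    with False show ?thesis by simp
  qed
  \<comment> \<open>Off \<open>S\<close> the shift vanishes, so the added factors are
    \<open>exp 0 = 1\<close>.\<close>
  have dens: "shift_density S a z = (\<Prod>j\<in>J \<union> S. ennreal (exp (a j * z j - (a j)\<^sup>2 / 2)))" for z
    unfolding shift_density_def using fin a by (intro prod.mono_neutral_left) auto
  have "emeasure ?D ?E = (\<integral>\<^sup>+z. indicator ?E z \<partial>?D)"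
    by simp
  also have "\<dots> = (\<integral>\<^sup>+z. indicator ?E (\<lambda>n. a n + z n) \<partial>gaussian_seq)"
    by (rule nn_integral_distr) measurable
  also have "\<dots> = (\<Prod>j\<in>J \<union> S. \<integral>\<^sup>+t. indicator (F' j) (a j + t) \<partial>std_gaussian)"
    unfolding ind by (rule nn_integral_gaussian_seq_prod) (use fin in auto)
  also have "\<dots> = (\<Prod>j\<in>J \<union> S. \<integral>\<^sup>+t. ennreal (exp (a j * t - (a j)\<^sup>2 / 2)) * indicator (F' j) t \<partial>std_gaussian)"
    by (subst nn_integral_std_gaussian_translate) auto
  also have "\<dots> = (\<integral>\<^sup>+z. (\<Prod>j\<in>J \<union> S. ennreal (exp (a j * z j - (a j)\<^sup>2 / 2)) * indicator (F' j) (z j)) \<partial>gaussian_seq)"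
    by (rule nn_integral_gaussian_seq_prod[symmetric]) (use fin in auto)
  also have "\<dots> = (\<integral>\<^sup>+z. shift_density S a z * indicator ?E z \<partial>gaussian_seq)"
    by (simp add: dens ind prod.distrib)
  also have "\<dots> = emeasure (density gaussian_seq (shift_density S a)) ?E"
    by (simp add: emeasure_density)
  finally show "emeasure ?D ?E = emeasure (density gaussian_seq (shift_density S a)) ?E" .
qed

section \<open>The second-moment bound on cylinders\<close>

text \<open>Cauchy-Schwarz separates the density \<open>L\<close> from the indicator of
  \<open>B\<close>. Writing the square of \<open>L\<close> as an integral over two independent
  signals and integrating out the noise first gives the exponential expectation.\<close>

lemma cylinder_signal_bound:
  fixes f :: "'b \<Rightarrow> nat \<Rightarrow> real"
  assumes P: "prob_space P" and f [measurable]: "f \<in> P \<rightarrow>\<^sub>M borel"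
    and B [measurable]: "B \<in> sets borel"
    and cyl: "\<And>z w. (\<And>n. n < k \<Longrightarrow> z n = w n) \<Longrightarrow> z \<in> B \<longleftrightarrow> w \<in> B"
  shows "(\<integral>\<^sup>+p. emeasure gaussian_seq {z. (\<lambda>n. f p n + z n) \<in> B} \<partial>P)\<^sup>2 \<le>
    (\<integral>\<^sup>+(p, q). ennreal (exp (\<Sum>n<k. f p n * f q n)) \<partial>(P \<Otimes>\<^sub>M P)) * emeasure gaussian_seq B"
proof -
  let ?G = gaussian_seq
  interpret P: prob_space P by fact
  interpret G: prob_space ?G by (rule prob_space_gaussian_seq)
  interpret PG: pair_sigma_finite P ?G ..
  interpret PP: pair_prob_space P P ..
  interpret PPG: pair_sigma_finite "P \<Otimes>\<^sub>M P" ?G ..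
  let ?l = "\<lambda>p z. shift_density {..<k} (f p) z"
  \<comment> \<open>\<open>L\<close> is the density of the first \<open>k\<close> coordinates of
    signal plus noise: the Cameron-Martin factor averaged over the signal.\<close>
  define L where "L z = (\<integral>\<^sup>+p. ?l p z \<partial>P)" for z
  have [measurable]: "L \<in> borel_measurable ?G"
    unfolding L_def by measurable
  have "emeasure ?G {z. (\<lambda>n. f p n + z n) \<in> B} = (\<integral>\<^sup>+z. ?l p z * indicator B z \<partial>?G)" for p
  proof -
    \<comment> \<open>Since \<open>B\<close> ignores the coordinates from \<open>k\<close> on, the
      shift may be cut off there, which makes its support finite.\<close>
    define a where "a n = (if n < k then f p n else 0)" for n
    have "{z. (\<lambda>n. f p n + z n) \<in> B} = {z. (\<lambda>n. a n + z n) \<in> B}"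
      by (intro Collect_cong cyl) (simp add: a_def)
    then have "emeasure ?G {z. (\<lambda>n. f p n + z n) \<in> B} = emeasure (distr ?G borel (\<lambda>z n. a n + z n)) B"
      by (simp add: emeasure_distr vimage_def)
    also have "\<dots> = (\<integral>\<^sup>+z. shift_density {..<k} a z * indicator B z \<partial>?G)"
      by (subst distr_gaussian_seq_shift[of "{..<k}"]) (auto simp: a_def emeasure_density)
    also have "\<dots> = (\<integral>\<^sup>+z. ?l p z * indicator B z \<partial>?G)"
      by (simp add: shift_density_def a_def)
    finally show ?thesis .
  qed
  then have "(\<integral>\<^sup>+p. emeasure ?G {z. (\<lambda>n. f p n + z n) \<in> B} \<partial>P) = (\<integral>\<^sup>+p. \<integral>\<^sup>+z. ?l p z * indicator B z \<partial>?G \<partial>P)"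
    by simp
  also have "\<dots> = (\<integral>\<^sup>+z. \<integral>\<^sup>+p. ?l p z * indicator B z \<partial>P \<partial>?G)"
    by (rule PG.Fubini'[symmetric]) measurable
  also have "\<dots> = (\<integral>\<^sup>+z. L z * indicator B z \<partial>?G)"
    by (simp add: L_def nn_integral_multc)
  also have "\<dots>\<^sup>2 \<le> (\<integral>\<^sup>+z. (L z)\<^sup>2 \<partial>?G) * (\<integral>\<^sup>+z. (indicator B z)\<^sup>2 \<partial>?G)"
    by (rule Cauchy_Schwarz_nn_integral) measurable
  also have "(\<integral>\<^sup>+z. (indicator B z)\<^sup>2 \<partial>?G) = (\<integral>\<^sup>+z. indicator B z \<partial>?G)"
    by (intro nn_integral_cong) (simp add: indicator_def)
  also have "\<dots> = emeasure ?G B"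
    by simp
  also have "(\<integral>\<^sup>+z. (L z)\<^sup>2 \<partial>?G) = (\<integral>\<^sup>+z. \<integral>\<^sup>+(p, q). ?l p z * ?l q z \<partial>(P \<Otimes>\<^sub>M P) \<partial>?G)"
  proof (intro nn_integral_cong)
    fix z
    have "(L z)\<^sup>2 = (\<integral>\<^sup>+p. \<integral>\<^sup>+q. ?l p z * ?l q z \<partial>P \<partial>P)"
      by (simp add: L_def power2_eq_square nn_integral_cmult nn_integral_multc)
    also have "\<dots> = (\<integral>\<^sup>+(p, q). ?l p z * ?l q z \<partial>(P \<Otimes>\<^sub>M P))"
      by (subst P.nn_integral_fst[symmetric]) simp_all
    finally show "(L z)\<^sup>2 = (\<integral>\<^sup>+(p, q). ?l p z * ?l q z \<partial>(P \<Otimes>\<^sub>M P))" .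
  qed
  also have "\<dots> = (\<integral>\<^sup>+r. \<integral>\<^sup>+z. ?l (fst r) z * ?l (snd r) z \<partial>?G \<partial>(P \<Otimes>\<^sub>M P))"
    unfolding case_prod_beta by (rule PPG.Fubini') measurable
  also have "\<dots> = (\<integral>\<^sup>+(p, q). ennreal (exp (\<Sum>n<k. f p n * f q n)) \<partial>(P \<Otimes>\<^sub>M P))"
    by (simp add: nn_integral_shift_density_mult case_prod_unfold)
  finally show ?thesis .
qed

section \<open>Compact sets as intersections of cylinders\<close>

text \<open>The hull is the preimage under the continuous truncation \<open>?r\<close> of the image
  of \<open>K\<close>, which is compact and hence closed.\<close>

lemma closed_cylinder_hull:
  fixes K :: "(nat \<Rightarrow> real) set"
  assumes "compact K"
  shows "closed {z. \<exists>w\<in>K. \<forall>n<k. z n = w n}"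
proof -
  let ?r = "\<lambda>(z :: nat \<Rightarrow> real) n. if n < k then z n else 0"
  have cont: "continuous_on UNIV ?r"
  proof (rule continuous_on_coordinatewise_then_product)
    show "continuous_on UNIV (\<lambda>z. ?r z n)" for n
      by (cases "n < k") simp_all
  qed
  have "closed (?r ` K)"
    by (intro compact_imp_closed compact_continuous_image assms continuous_on_subset[OF cont]) simp
  then have "closed (?r -` (?r ` K))"
    by (rule closed_vimage[OF _ cont])
  also have "?r -` (?r ` K) = {z. \<exists>w\<in>K. \<forall>n<k. z n = w n}"
    by (auto simp: fun_eq_iff image_iff) metis+
  finally show ?thesis .
qed

text \<open>A point of every hull is a limit of points of \<open>K\<close> agreeing with it on ever
  longer initial segments, since convergence in the product topology is coordinatewise.\<close>

lemma Inter_cylinder_hull: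
  fixes K :: "(nat \<Rightarrow> real) set"
  assumes "closed K"
  shows "(\<Inter>k. {z. \<exists>w\<in>K. \<forall>n<k. z n = w n}) = K"
proof (intro equalityI subsetI)
  fix z assume "z \<in> (\<Inter>k. {z. \<exists>w\<in>K. \<forall>n<k. z n = w n})"
  then have "\<forall>k. \<exists>w. w \<in> K \<and> (\<forall>n<k. z n = w n)" by auto
  then obtain w where w: "\<And>k. w k \<in> K" "\<And>k n. n < k \<Longrightarrow> z n = w k n" by metis
  have "(\<lambda>k. w k n) \<longlonglongrightarrow> z n" for n
    \<comment> \<open>From \<open>k = Suc n\<close> on, coordinate \<open>n\<close> of
      \<open>w k\<close> equals \<open>z n\<close>.\<close>
    by (rule tendsto_eventually) (auto simp: eventually_sequentially Suc_le_eq intro!: exI[of _ "Suc n"] w(2)[symmetric])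
  then have "w \<longlonglongrightarrow> z"
    by (simp add: limitin_componentwise flip: limitin_canonical_iff euclidean_product_topology)
  then show "z \<in> K"
    using assms w(1) by (metis closed_sequentially)
qed auto

section \<open>Absolute continuity of signal plus noise\<close>

text \<open>Entering the signal through a measurable map \<open>f\<close> lets \<open>P\<close> live
  on a space other than the full sequence space, such as \<open>X\<close> with its trace
  sigma-field.\<close>

lemma null_set_signal_plus_noise:
  fixes f :: "'b \<Rightarrow> nat \<Rightarrow> real"
  assumes P: "prob_space P" and f [measurable]: "f \<in> P \<rightarrow>\<^sub>M borel"
    and energy: "liminf (\<lambda>k. \<integral>\<^sup>+(p, q). ennreal (exp (\<Sum>n<k. f p n * f q n)) \<partial>(P \<Otimes>\<^sub>M P)) < \<infinity>"
    and A [measurable]: "A \<in> sets borel" and null: "emeasure gaussian_seq A = 0"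
  shows "(\<integral>\<^sup>+p. emeasure gaussian_seq {z. (\<lambda>n. f p n + z n) \<in> A} \<partial>P) = 0"
proof -
  let ?G = gaussian_seq
  interpret P: prob_space P by fact
  interpret G: prob_space ?G by (rule prob_space_gaussian_seq)
  interpret PG: pair_prob_space P ?G ..
  define Q where "Q = distr (P \<Otimes>\<^sub>M ?G) borel (\<lambda>(p, z) n. f p n + z n)"
  have sets_Q [simp]: "sets Q = sets borel" by (simp add: Q_def)
  interpret Q: prob_space Q
    unfolding Q_def by (rule PG.prob_space_distr) measurable
  have Q: "emeasure Q B = (\<integral>\<^sup>+p. emeasure ?G {z. (\<lambda>n. f p n + z n) \<in> B} \<partial>P)"
    if [measurable]: "B \<in> sets borel" for B
    unfolding Q_def
    by (subst emeasure_distr, measurable, subst G.emeasure_pair_measure_alt)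
       (auto simp: space_pair_measure vimage_def intro!: nn_integral_cong arg_cong2[where f = emeasure])
  \<comment> \<open>\<open>C\<close> lies strictly between the liminf and infinity, so the
    expectations are below \<open>C\<close> for infinitely many \<open>k\<close>, though perhaps not
    for all large \<open>k\<close>.\<close>
  obtain C where C: "C < \<infinity>"
    and inf: "\<exists>\<^sub>F k in sequentially. (\<integral>\<^sup>+(p, q). ennreal (exp (\<Sum>n<k. f p n * f q n)) \<partial>(P \<Otimes>\<^sub>M P)) < C"
  proof -
    obtain C where C: "liminf (\<lambda>k. \<integral>\<^sup>+(p, q). ennreal (exp (\<Sum>n<k. f p n * f q n)) \<partial>(P \<Otimes>\<^sub>M P)) < C" "C < \<infinity>"
      using dense[OF energy] by blast
    show thesis
    proof (rule that[OF C(2)], rule ccontr)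
      assume "\<not> (\<exists>\<^sub>F k in sequentially. (\<integral>\<^sup>+(p, q). ennreal (exp (\<Sum>n<k. f p n * f q n)) \<partial>(P \<Otimes>\<^sub>M P)) < C)"
      then have "C \<le> liminf (\<lambda>k. \<integral>\<^sup>+(p, q). ennreal (exp (\<Sum>n<k. f p n * f q n)) \<partial>(P \<Otimes>\<^sub>M P))"
        by (intro Liminf_bounded) (simp add: not_frequently not_less)
      with C(1) show False by simp
    qed
  qed
  have "emeasure Q K = 0" if K: "K \<subseteq> A" "compact K" for K
  proof -
    \<comment> \<open>The cylinders \<open>H k\<close> shrink to \<open>K\<close>, so their Gaussian
      measures tend to that of \<open>K\<close>, which is 0.\<close>
    define H where "H k = {z. \<exists>w\<in>K. \<forall>n<k. z n = w n}" for k
    have [measurable]: "H k \<in> sets borel" for k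
      unfolding H_def using closed_cylinder_hull[OF K(2)] by (rule borel_closed)
    have [measurable]: "K \<in> sets borel"
      using K by (intro borel_closed compact_imp_closed)
    have int: "(\<Inter>k. H k) = K"
      unfolding H_def using K by (intro Inter_cylinder_hull compact_imp_closed)
    have "decseq H"
      unfolding H_def by (intro antimonoI) (blast intro: order_less_le_trans)
    then have "(\<lambda>k. emeasure ?G (H k)) \<longlonglongrightarrow> emeasure ?G (\<Inter>k. H k)"
      by (intro Lim_emeasure_decseq) auto
    moreover have "emeasure ?G K = 0"
      using emeasure_mono[OF K(1), of ?G] null by simp
    ultimately have "(\<lambda>k. C * emeasure ?G (H k)) \<longlonglongrightarrow> C * 0"
      using C by (intro ennreal_tendsto_cmult) (auto simp: int)
    have "(emeasure Q K)\<^sup>2 \<le> 0"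
    proof (rule ccontr)
      assume "\<not> (emeasure Q K)\<^sup>2 \<le> 0"
      then have "C * 0 < (emeasure Q K)\<^sup>2"
        unfolding not_le by simp
      then have "\<forall>\<^sub>F k in sequentially. C * emeasure ?G (H k) < (emeasure Q K)\<^sup>2"
        using \<open>(\<lambda>k. C * emeasure ?G (H k)) \<longlonglongrightarrow> C * 0\<close> by (rule order_tendstoD(2)[rotated])
      \<comment> \<open>The first bound holds for all large \<open>k\<close> and the second for
        infinitely many, so some \<open>k\<close> satisfies both.\<close>
      then obtain k where k: "C * emeasure ?G (H k) < (emeasure Q K)\<^sup>2"
        "(\<integral>\<^sup>+(p, q). ennreal (exp (\<Sum>n<k. f p n * f q n)) \<partial>(P \<Otimes>\<^sub>M P)) < C"
        using frequently_ex[OF frequently_eventually_frequently[OF inf]] by blast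
      have "(emeasure Q K)\<^sup>2 \<le> (emeasure Q (H k))\<^sup>2"
        using int by (intro power_mono emeasure_mono) auto
      also have "\<dots> \<le> (\<integral>\<^sup>+(p, q). ennreal (exp (\<Sum>n<k. f p n * f q n)) \<partial>(P \<Otimes>\<^sub>M P)) * emeasure ?G (H k)"
        unfolding Q[OF \<open>H k \<in> sets borel\<close>]
        by (rule cylinder_signal_bound[OF P f]) (simp, simp add: H_def)
      also have "\<dots> \<le> C * emeasure ?G (H k)"
        using k(2) by (intro mult_right_mono) auto
      finally show False using k(1) by simp
    qed
    then show ?thesis by simp
  qed
  \<comment> \<open>A finite Borel measure on this Polish space is inner regular, so compact subsets
    of \<open>A\<close> decide whether \<open>A\<close> is null.\<close>
  then have "(SUP K\<in>{K. K \<subseteq> A \<and> compact K}. emeasure Q K) \<le> 0"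
    by (intro SUP_least) simp
  then have "emeasure Q A = 0"
    using inner_regular[of Q A] by simp
  then show ?thesis by (simp add: Q)
qed

section \<open>The law of the noise and the conclusion\<close>

text \<open>Independence makes the joint law the product of the marginals, so events on
  \<open>M\<close> can be measured by \<open>gaussian_seq\<close>.\<close>

lemma distr_standard_gaussian_noise:
  assumes "standard_gaussian_noise M \<xi>"
  shows "(\<lambda>\<omega> n. \<xi> n \<omega>) \<in> M \<rightarrow>\<^sub>M borel"
    and "distr M borel (\<lambda>\<omega> n. \<xi> n \<omega>) = gaussian_seq"
proof -
  interpret prob_space M
    using assms by (simp add: standard_gaussian_noise_def)
  have ind: "indep_vars (\<lambda>_. borel) \<xi> UNIV"
    and dist: "distributed M lborel (\<xi> n) (\<lambda>t. ennreal (std_normal_density t))" for n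
    using assms by (auto simp: standard_gaussian_noise_def)
  have [measurable]: "\<xi> n \<in> borel_measurable M" for n
    using distributed_measurable[OF dist] by simp
  show "(\<lambda>\<omega> n. \<xi> n \<omega>) \<in> M \<rightarrow>\<^sub>M borel"
    by (rule measurable_coordinatewise_then_product) measurable
  have "distr M (PiM UNIV (\<lambda>_. borel)) (\<lambda>\<omega>. \<lambda>n\<in>UNIV. \<xi> n \<omega>) = PiM UNIV (\<lambda>n. distr M borel (\<xi> n))"
    using ind by (subst (asm) indep_vars_iff_distr_eq_PiM') auto
  also have "(\<lambda>n. distr M borel (\<xi> n)) = (\<lambda>_. std_gaussian)"
    using distributed_distr_eq_density[OF dist] by (simp cong: distr_cong)
  finally have "distr M (PiM UNIV (\<lambda>_. borel)) (\<lambda>\<omega> n. \<xi> n \<omega>) = gaussian_seq"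
    by (simp add: gaussian_seq_def)
  then show "distr M borel (\<lambda>\<omega> n. \<xi> n \<omega>) = gaussian_seq"
    using distr_cong[OF refl sets_PiM_equal_borel refl] by metis
qed

theorem theorem1p5:
  fixes M :: "'a measure" and \<xi> :: "nat \<Rightarrow> 'a \<Rightarrow> real"
    and X :: "(nat \<Rightarrow> real) set" and P :: "(nat \<Rightarrow> real) measure"
  assumes "standard_gaussian_noise M \<xi>"
    and "X \<in> sets borel"
    and "prob_space P" and "sets P = sets (restrict_space borel X)"
    and "liminf (\<lambda>k. \<integral>\<^sup>+ (x, y). ennreal (exp (\<Sum>n<k. x n * y n)) \<partial>(P \<Otimes>\<^sub>M P)) < \<infinity>"
  shows "\<not> admits_detection M \<xi> X"
proof
  assume "admits_detection M \<xi> X"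
  then obtain T :: "(nat \<Rightarrow> real) \<Rightarrow> nat"
    where T [measurable]: "T \<in> borel \<rightarrow>\<^sub>M count_space {0, 1}"
      and T0: "AE \<omega> in M. T (\<lambda>n. \<xi> n \<omega>) = 0"
      and T1: "\<And>x. x \<in> X \<Longrightarrow> AE \<omega> in M. T (\<lambda>n. x n + \<xi> n \<omega>) = 1"
    unfolding admits_detection_def by blast
  interpret P: prob_space P by fact
  interpret M: prob_space M
    using assms(1) by (simp add: standard_gaussian_noise_def)
  note [measurable] = distr_standard_gaussian_noise(1)[OF assms(1)]
  define A where "A = {z. T z = 1}"
  have A [measurable]: "A \<in> sets borel"
    using measurable_sets[OF T, of "{1}"] by (simp add: A_def vimage_def)
  \<comment> \<open>Used twice: \<open>x = 0\<close> gives the noise alone, and \<open>x\<close> in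
    \<open>X\<close> gives a shifted signal.\<close>
  have G: "emeasure gaussian_seq {z. (\<lambda>n. x n + z n) \<in> A} = emeasure M {\<omega>\<in>space M. T (\<lambda>n. x n + \<xi> n \<omega>) = 1}" for x
    unfolding distr_standard_gaussian_noise(2)[OF assms(1), symmetric]
    by (subst emeasure_distr) (auto simp: A_def vimage_def intro!: arg_cong2[where f = emeasure])
  have "emeasure gaussian_seq A = emeasure M {\<omega>\<in>space M. T (\<lambda>n. \<xi> n \<omega>) = 1}"
    using G[of "\<lambda>_. 0"] by simp
  also have "\<dots> = 0"
    using T0 by (intro emeasure_eq_0_AE) auto
  finally have null: "emeasure gaussian_seq A = 0" .
  \<comment> \<open>\<open>P\<close> carries the trace of the Borel sets on \<open>X\<close>, so the
    signal map is the inclusion.\<close>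
  have "(\<lambda>x. x) \<in> P \<rightarrow>\<^sub>M borel"
    by (subst measurable_cong_sets[OF assms(4) refl]) (rule measurable_restrict_space1, simp)
  then have "(\<integral>\<^sup>+x. emeasure gaussian_seq {z. (\<lambda>n. x n + z n) \<in> A} \<partial>P) = 0"
    using null_set_signal_plus_noise[of P "\<lambda>x. x" A] assms A null by simp
  \<comment> \<open>Detection makes the integrand 1 on all of \<open>space P\<close>, which has mass
    1, contradicting the integral 0.\<close>
  moreover have "emeasure gaussian_seq {z. (\<lambda>n. x n + z n) \<in> A} = 1" if "x \<in> space P" for x
  proof -
    have "x \<in> X"
      using that sets_eq_imp_space_eq[OF assms(4)] by (simp add: space_restrict_space)
    then show ?thesis
      unfolding G using T1[of x] by (subst M.AE_iff_emeasure_eq_1[symmetric]) auto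
  qed
  ultimately show False
    by (simp add: P.emeasure_space_1 cong: nn_integral_cong)
qed

end
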